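(* Let $G(s)$ be the delay-free plant of relative degree $\beta-\alpha$ and $\tau>0$ the input delay described in the context, let $\omega_1,\dots,\omega_k>0$ be the targeted frequencies, and consider the Internal Model Control scheme in the ideal configuration, i.e. when the model and the system perfectly match, with controller $Q(s)e^{-s\theta}$. Suppose that $$Q(s)=\frac{1}{G(s)}F(s),$$ where $F(s)$ is a low-pass filter with relative degree $n_r$ satisfying $n_r\ge \beta-\alpha$, and such that, for all $i=1,\dots,k$, $$F(0)=\left|F(\mathrm{j}\omega_i)\right|=1,\qquad \angle F(\mathrm{j}\omega_i)-\omega_i(\tau+\theta)=2\pi h\ \text{ for some } h\in\mathbb{Z}.$$ Then the sensitivity $S(s)=1-Q(s)G(s)e^{-s(\tau+\theta)}$ satisfies the periodic control condition $$S(0)=S(\mathrm{j}\omega_i)=0,\qquad i=1,\dots,k.$$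
   Context: Plant: $G_\tau(s)=G(s)e^{-s\tau}$ with delay $\tau>0$ and $$G(s)=\frac{a_\alpha s^\alpha+\dots+a_1s+a_0}{b_\beta s^\beta+\dots+b_1s+b_0},\qquad \beta\ge\alpha,\ \alpha,\beta\in\mathbb{N},$$ where numerator and denominator are Hurwitz polynomials (so $G$ is stable, proper and minimum phase), of degrees $\alpha$ and $\beta$. Internal Model Control (IMC) scheme: the true system is $G_s(s)e^{-s\tau_s}$, its model is $G_m(s)e^{-s\tau_m}$, the controller is $Q(s)e^{-s\theta}$ with controller delay $\theta\geq 0$. With reference $r$, output disturbance $d$, control input $u$, output $y$: $y=G_se^{-s\tau_s}u+d$, $y_m=G_me^{-s\tau_m}u$, $u=Qe^{-s\theta}\bigl(r-(y-y_m)\bigr)$ (in the Laplace domain). The sensitivity is $S(s)=Y(s)/D(s)$, where $Y(s)$ and $D(s)$ are the Laplace transforms of $y$ and $d$ (with $r=0$). The ideal configuration means $G_s=G_m=G$ and $\tau_s=\tau_m=\tau$; then $S(s)=1-Q(s)G(s)e^{-s(\tau+\theta)}$. The symbol $\angle$ denotes the argument (phase) of a complex number and $\mathrm{j}$ the imaginary unit. *)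

theory Defs
  imports Complex_Main "HOL-Computational_Algebra.Polynomial"
begin

definition cpoly :: "real poly \<Rightarrow> complex \<Rightarrow> complex" where
  "cpoly p s = poly (map_poly complex_of_real p) s"

definition hurwitz :: "real poly \<Rightarrow> bool" where
  "hurwitz p \<longleftrightarrow> p \<noteq> 0 \<and> (\<forall>s. cpoly p s = 0 \<longrightarrow> Re s < 0)"

definition transfer :: "real poly \<Rightarrow> real poly \<Rightarrow> complex \<Rightarrow> complex" where
  "transfer p q s = cpoly p s / cpoly q s"

definition relative_degree :: "real poly \<Rightarrow> real poly \<Rightarrow> int" where
  "relative_degree p q = int (degree q) - int (degree p)"

text \<open>
  A low-pass filter is a stable rational filter whose gain at high frequency is
  below its gain at frequency zero. The limit L is 0 when the relative degree is
  positive; a positive L allows biproper filters (relative degree 0).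
\<close>

definition low_pass_filter :: "real poly \<Rightarrow> real poly \<Rightarrow> bool" where
  "low_pass_filter p q \<longleftrightarrow> hurwitz q \<and>
     (\<exists>L. ((\<lambda>w::real. cmod (transfer p q (\<i> * complex_of_real w))) \<longlongrightarrow> L) at_top \<and>
          L < cmod (transfer p q 0))"

text \<open>
  The equations of the internal model control loop, read at one point s of the
  Laplace domain: r, d, u, y, ym are the values at s of the transforms of the
  reference, the output disturbance, the control input, the output and the
  model output.
\<close>

definition imc_loop ::
  "(complex \<Rightarrow> complex) \<Rightarrow> real \<Rightarrow> (complex \<Rightarrow> complex) \<Rightarrow> real \<Rightarrow> (complex \<Rightarrow> complex) \<Rightarrow> real \<Rightarrow>
   complex \<Rightarrow> complex \<Rightarrow> complex \<Rightarrow> complex \<Rightarrow> complex \<Rightarrow> complex \<Rightarrow> bool" where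
  "imc_loop Gs \<tau>s Gm \<tau>m Q \<theta> s r d u y ym \<longleftrightarrow>
     y = Gs s * exp (- s * complex_of_real \<tau>s) * u + d \<and>
     ym = Gm s * exp (- s * complex_of_real \<tau>m) * u \<and>
     u = Q s * exp (- s * complex_of_real \<theta>) * (r - (y - ym))"

text \<open>
  The common value of the quotient y / d over all solutions of the loop equations
  with zero reference. It is well defined wherever the loop equations are uniquely
  solvable, in particular everywhere when model and system coincide.
\<close>

definition imc_sensitivity ::
  "(complex \<Rightarrow> complex) \<Rightarrow> real \<Rightarrow> (complex \<Rightarrow> complex) \<Rightarrow> real \<Rightarrow> (complex \<Rightarrow> complex) \<Rightarrow> real \<Rightarrow>
   complex \<Rightarrow> complex" where
  "imc_sensitivity Gs \<tau>s Gm \<tau>m Q \<theta> s =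
     (THE S. \<forall>d u y ym. d \<noteq> 0 \<and> imc_loop Gs \<tau>s Gm \<tau>m Q \<theta> s 0 d u y ym \<longrightarrow> S = y / d)"

end

theory Submission
  imports Defs
begin

text \<open>
  When model and system coincide, \<open>y - ym = d\<close>, so the loop is open and the sensitivity is
  \<open>1 - Q G exp (- s (\<tau> + \<theta>))\<close>. Hurwitz polynomials do not vanish on the imaginary axis, hence \<open>Q G = F\<close>
  there, and the phase condition makes \<open>F\<close> cancel the delay factor at the targeted frequencies.
\<close>

text \<open>The definite description takes this value because all loop solutions with
  \<open>d \<noteq> 0\<close> share one quotient (\<open>quotient\<close>) and at least one such
  solution exists (\<open>solvable\<close>).\<close>

lemma imc_sensitivity_ideal:
  "imc_sensitivity G \<tau> G \<tau> Q \<theta> s = 1 - Q s * G s * exp (- s * complex_of_real (\<tau> + \<theta>))"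
proof -
  let ?E = "exp (- s * complex_of_real (\<tau> + \<theta>))"
  have E: "?E = exp (- s * complex_of_real \<tau>) * exp (- s * complex_of_real \<theta>)"
    by (simp add: exp_add [symmetric] algebra_simps)
  have quotient: "y / d = 1 - Q s * G s * ?E"
    if "d \<noteq> 0" and loop: "imc_loop G \<tau> G \<tau> Q \<theta> s 0 d u y ym" for d u y ym
  proof -
    have y: "y = G s * exp (- s * complex_of_real \<tau>) * u + d"
      and ym: "ym = G s * exp (- s * complex_of_real \<tau>) * u"
      and u: "u = Q s * exp (- s * complex_of_real \<theta>) * (0 - (y - ym))"
      using loop unfolding imc_loop_def by blast+
    have "y - ym = d"
      by (simp only: y ym add_diff_cancel_left')
    with u have "u = - (Q s * exp (- s * complex_of_real \<theta>) * d)"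
      by (simp only: diff_0 mult_minus_right)
    with y have "y = (1 - Q s * G s * ?E) * d"
      unfolding E by (simp add: algebra_simps)
    then show ?thesis
      using \<open>d \<noteq> 0\<close> by simp
  qed
  \<comment> \<open>Without a solution every \<open>S\<close> would satisfy the defining condition
    vacuously and uniqueness would fail. The witness for \<open>u\<close> is the open-loop control
    answering \<open>d = 1\<close>; the equations then fix \<open>y\<close> and
    \<open>ym\<close>.\<close>
  have solvable: "\<exists>u y ym. imc_loop G \<tau> G \<tau> Q \<theta> s 0 1 u y ym"
    unfolding imc_loop_def
    by (rule exI [of _ "- (Q s * exp (- s * complex_of_real \<theta>))"]) simp
  show ?thesis
    unfolding imc_sensitivity_def
  proof (rule the_equality)
    show "\<forall>d u y ym. d \<noteq> 0 \<and> imc_loop G \<tau> G \<tau> Q \<theta> s 0 d u y ym \<longrightarrow>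
        1 - Q s * G s * ?E = y / d"
      by (blast intro: quotient [symmetric])
  next
    fix S
    assume "\<forall>d u y ym. d \<noteq> 0 \<and> imc_loop G \<tau> G \<tau> Q \<theta> s 0 d u y ym \<longrightarrow> S = y / d"
    moreover obtain u y ym where "imc_loop G \<tau> G \<tau> Q \<theta> s 0 1 u y ym"
      using solvable by blast
    ultimately have "S = y / 1"
      using one_neq_zero by blast
    also have "\<dots> = 1 - Q s * G s * ?E"
      by (rule quotient) (simp, fact)
    finally show "S = 1 - Q s * G s * ?E" .
  qed
qed

text \<open>All roots of \<open>a\<close> and \<open>b\<close> lie in the open left half-plane. The
  denominator matters too: at a root of \<open>b\<close> the quotient would be 0, since
  \<open>x / 0 = 0\<close>.\<close>

lemma transfer_hurwitz_nonzero:
  assumes "hurwitz a" "hurwitz b" "Re s \<ge> 0"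
  shows "transfer a b s \<noteq> 0"
  using assms unfolding hurwitz_def transfer_def by force

text \<open>A number of modulus 1 is \<open>cis\<close> of its argument, so multiplying by the delay
  factor subtracts \<open>x\<close> from the phase and leaves a multiple of
  \<open>2 * pi\<close>.\<close>

lemma mult_exp_delay_eq_1:
  assumes "cmod z = 1" and "Arg z - x = 2 * pi * of_int h"
  shows "z * exp (- (\<i> * complex_of_real x)) = 1"
proof -
  have "z \<noteq> 0"
    using assms(1) by auto
  then have "z = cis (Arg z)"
    using assms(1) by (simp add: cis_Arg sgn_eq)
  moreover have "exp (- (\<i> * complex_of_real x)) = cis (- x)"
    by (simp add: cis_conv_exp)
  ultimately have "z * exp (- (\<i> * complex_of_real x)) = cis (Arg z - x)"
    by (metis cis_mult diff_conv_add_uminus)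
  also have "\<dots> = 1"
    unfolding assms(2) by (rule cis_multiple_2pi) simp
  finally show ?thesis .
qed

theorem proposition1:
  fixes a b p q :: "real poly"
    and \<alpha> \<beta> k :: nat
    and n_r :: int
    and \<tau> \<theta> :: real
    and \<omega> :: "nat \<Rightarrow> real"
    and G F Q S :: "complex \<Rightarrow> complex"
  assumes "hurwitz a" and "hurwitz b"
    and "degree a = \<alpha>" and "degree b = \<beta>" and "\<beta> \<ge> \<alpha>"
    and "G = transfer a b"
    and "\<tau> > 0" and "\<theta> \<ge> 0"
    and "\<forall>i\<in>{1..k}. \<omega> i > 0"
    and "F = transfer p q" and "low_pass_filter p q"
    and "relative_degree p q = n_r" and "n_r \<ge> int \<beta> - int \<alpha>"
    and "\<forall>s. Q s = 1 / G s * F s"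
    and "F 0 = 1"
    and "\<forall>i\<in>{1..k}. cmod (F (\<i> * complex_of_real (\<omega> i))) = 1"
    and "\<forall>i\<in>{1..k}. \<exists>h::int.
           Arg (F (\<i> * complex_of_real (\<omega> i))) - \<omega> i * (\<tau> + \<theta>) = 2 * pi * of_int h"
    and "S = imc_sensitivity G \<tau> G \<tau> Q \<theta>"
  shows "(\<forall>s. S s = 1 - Q s * G s * exp (- s * complex_of_real (\<tau> + \<theta>))) \<and>
         S 0 = 0 \<and> (\<forall>i\<in>{1..k}. S (\<i> * complex_of_real (\<omega> i)) = 0)"
proof -
  have S: "S s = 1 - Q s * G s * exp (- s * complex_of_real (\<tau> + \<theta>))" for s
    using assms(18) by (simp add: imc_sensitivity_ideal)
  \<comment> \<open>Cancelling \<open>G s\<close> against \<open>1 / G s\<close> requires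
    \<open>G s \<noteq> 0\<close>, hence the restriction to the closed right half-plane, which
    contains 0 and the imaginary axis.\<close>
  have QG: "Q s * G s = F s" if "Re s \<ge> 0" for s
    using transfer_hurwitz_nonzero [OF assms(1,2) that] assms(6,14) by simp
  \<comment> \<open>At \<open>s = 0\<close> the delay factor is 1, so the unit gain
    \<open>F 0 = 1\<close> gives the zero.\<close>
  have "S 0 = 0"
    using S [of 0] QG [of 0] assms(15) by simp
  moreover have "S (\<i> * complex_of_real (\<omega> i)) = 0" if i: "i \<in> {1..k}" for i
  proof -
    let ?s = "\<i> * complex_of_real (\<omega> i)"
    obtain h :: int where "Arg (F ?s) - \<omega> i * (\<tau> + \<theta>) = 2 * pi * of_int h"
      using assms(17) i by blast
    then have "F ?s * exp (- (\<i> * complex_of_real (\<omega> i * (\<tau> + \<theta>)))) = 1"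
      using assms(16) i by (intro mult_exp_delay_eq_1) auto
    \<comment> \<open>This matches the exponent in \<open>S\<close> with
      \<open>x = \<omega> i * (\<tau> + \<theta>)\<close>, the phase lag of the total delay.\<close>
    moreover have "- ?s * complex_of_real (\<tau> + \<theta>) = - (\<i> * complex_of_real (\<omega> i * (\<tau> + \<theta>)))"
      by (simp only: of_real_mult mult_minus_left mult.assoc)
    moreover have "Q ?s * G ?s = F ?s"
      by (rule QG) simp
    ultimately show ?thesis
      unfolding S [of ?s] by (simp only: diff_self)
  qed
  ultimately show ?thesis
    using S by blast
qed

end
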